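(* Let $G$ be a finite simple graph and let $\lambda,\alpha\ge 0$ be reals. Write $d_v\coloneqq\deg_G(v)$. Then \[ Z_G(\lambda;\alpha)\ \ge\ \prod_{v\in V(G)} Z_{K_{d_v+1}}(\lambda;\alpha)^{\frac{1}{d_v+1}}=\prod_{v\in V(G)}\bigl((d_v+1)\lambda\alpha^{d_v}+1\bigr)^{\frac{1}{d_v+1}}. \]
   Context: For a graph $G$, $\mathcal{I}(G)$ denotes the set of independent sets of $G$ (including the empty set), and $Z_G(\lambda;\alpha)\coloneqq\sum_{I\in\mathcal{I}(G)}\lambda^{|I|}\alpha^{e(I,\overline{I})}$, where $e(I,\overline{I})$ is the number of edges of $G$ with one endpoint in $I$ and the other in $V(G)\setminus I$ (with $0^0=1$). $K_m$ denotes the complete graph on $m$ vertices. *)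

theory Defs
  imports Complex_Main "Graph_Theory.Graph_Theory"
begin

text \<open>
  A finite simple graph is a \<^locale>\<open>graph\<close> of the Graph Theory entry: a finite, symmetric,
  loop-free digraph without parallel arcs. An undirected edge \<open>{u, v}\<close> is represented by the two
  arcs \<open>(u, v)\<close> and \<open>(v, u)\<close>, so the degree of a vertex is its \<^const>\<open>out_degree\<close>.
\<close>

definition edges :: "('a, 'b) pre_digraph \<Rightarrow> 'a set set" where
  "edges G = (\<lambda>a. {tail G a, head G a}) ` arcs G"

definition independent_sets :: "('a, 'b) pre_digraph \<Rightarrow> 'a set set" where
  "independent_sets G = {I. I \<subseteq> verts G \<and> (\<forall>u\<in>I. \<forall>v\<in>I. {u, v} \<notin> edges G)}"

definition cut_size :: "('a, 'b) pre_digraph \<Rightarrow> 'a set \<Rightarrow> nat" where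
  "cut_size G I = card {e \<in> edges G. \<exists>u\<in>I. \<exists>v\<in>verts G - I. e = {u, v}}"

text \<open>All exponents are natural numbers, so \<open>0 ^ 0 = 1\<close>.\<close>

definition Z :: "('a, 'b) pre_digraph \<Rightarrow> real \<Rightarrow> real \<Rightarrow> real" where
  "Z G lam \<alpha> = (\<Sum>I\<in>independent_sets G. lam ^ card I * \<alpha> ^ cut_size G I)"

definition complete_graph :: "nat \<Rightarrow> (nat, nat \<times> nat) pre_digraph" where
  "complete_graph m =
     \<lparr>verts = {..<m}, arcs = {(i, j). i < m \<and> j < m \<and> i \<noteq> j}, tail = fst, head = snd\<rparr>"

lemma complete_digraph_complete_graph: "complete_digraph m (complete_graph m)"
proof -
  have "finite (arcs (complete_graph m))"
    by (rule finite_subset[of _ "{..<m} \<times> {..<m}"]) (auto simp: complete_graph_def)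
  then have "graph (complete_graph m)"
    by unfold_locales
      (auto simp: complete_graph_def arc_to_ends_def symmetric_def arcs_ends_def sym_def)
  then show ?thesis
    by (auto simp: complete_digraph_def complete_graph_def arcs_ends_def arc_to_ends_def)
qed

end

theory Submission
  imports Defs "HOL-Analysis.Convex"
begin

text \<open>
  For an independent set \<open>I\<close> every edge at a vertex of \<open>I\<close> leaves \<open>I\<close>, so \<open>Z G\<close> is the independence
  polynomial with vertex weights \<open>w v = \<lambda> * \<alpha> ^ d v\<close>. The bound
  \<open>(\<Prod>v. ((d v + 1) * w v + 1) powr (1 / (d v + 1)))\<close> in fact holds for arbitrary nonnegative weights,
  and decoupling the weights from the degrees makes induction on the vertex set possible: with \<open>v\<close> of
  maximum degree, \<open>Z(S) = Z(S - v) + w v * Z(S - N[v])\<close>. Deleting \<open>v\<close> lowers the degree of each of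
  its neighbours by one, and the gain in their factors is compared with \<open>w v\<close> by a one-variable
  inequality for each neighbour, then Hoelder's inequality over the neighbours, then Young's
  inequality to bring in the factor of \<open>v\<close>. Maximality of the degree enters in the one-variable step.
\<close>

section \<open>Superadditivity of the geometric mean\<close>

text \<open>AM-GM is applied to the ratios \<open>x i / (x i + y i)\<close> and
  \<open>y i / (x i + y i)\<close>, whose arithmetic means add up to 1. This is the form of
  Hoelder's inequality needed over a neighbourhood.\<close>

lemma geometric_mean_superadditive:
  fixes x y :: "'a \<Rightarrow> real"
  assumes "finite S" "S \<noteq> {}"
    and "\<And>i. i \<in> S \<Longrightarrow> x i > 0" "\<And>i. i \<in> S \<Longrightarrow> y i > 0"
  shows "(\<Prod>i\<in>S. x i) powr (1 / card S) + (\<Prod>i\<in>S. y i) powr (1 / card S)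
           \<le> (\<Prod>i\<in>S. x i + y i) powr (1 / card S)"
proof -
  let ?p = "1 / real (card S)" and ?s = "\<lambda>i. x i + y i"
  have s: "?s i > 0" if "i \<in> S" for i
    using assms(3,4)[OF that] by simp
  have x0: "(\<Prod>i\<in>S. x i) \<ge> 0" and y0: "(\<Prod>i\<in>S. y i) \<ge> 0" and s0: "(\<Prod>i\<in>S. ?s i) > 0"
    using assms(3,4) s by (auto intro!: prod_nonneg prod_pos less_imp_le)
  have "(\<Prod>i\<in>S. x i / ?s i) powr ?p + (\<Prod>i\<in>S. y i / ?s i) powr ?p
      \<le> (\<Sum>i\<in>S. (x i / ?s i) / card S) + (\<Sum>i\<in>S. (y i / ?s i) / card S)"
    using assms(3,4) s
    by (intro add_mono arith_geom_mean assms(1,2)) (auto intro!: divide_nonneg_pos less_imp_le)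
  also have "\<dots> = (\<Sum>i\<in>S. 1 / card S)"
    unfolding sum.distrib[symmetric]
    using s by (intro sum.cong refl) (simp add: add_divide_distrib[symmetric] less_imp_neq[symmetric])
  also have "\<dots> = 1"
    using assms(1,2) by simp
  finally have "((\<Prod>i\<in>S. x i) powr ?p + (\<Prod>i\<in>S. y i) powr ?p) / (\<Prod>i\<in>S. ?s i) powr ?p \<le> 1"
    using x0 y0 s0 by (simp add: prod_dividef powr_divide add_divide_distrib)
  then show ?thesis
    using s0 by (simp add: divide_le_eq)
qed

section \<open>One-variable inequalities for the factor of a clique\<close>

text \<open>At \<open>x = lam * \<alpha> ^ k\<close> this is the normalised partition function of
  the clique on \<open>k + 1\<close> vertices.\<close>

definition clique_factor :: "nat \<Rightarrow> real \<Rightarrow> real" where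
  "clique_factor k x = (real (k + 1) * x + 1) powr (1 / real (k + 1))"

lemma clique_factor_pos:
  assumes "x \<ge> 0"
  shows "clique_factor k x > 0"
proof -
  have "real (k + 1) * x + 1 > 0"
    using assms by (simp add: add_nonneg_pos)
  then show ?thesis
    unfolding clique_factor_def by simp
qed

lemma clique_factor_power:
  assumes "x \<ge> 0"
  shows "clique_factor k x ^ n = (real (k + 1) * x + 1) powr (real n / real (k + 1))"
proof -
  have "clique_factor k x ^ n = clique_factor k x powr real n"
    using clique_factor_pos[OF assms] by (simp add: powr_realpow)
  then show ?thesis
    by (simp add: clique_factor_def powr_powr)
qed

lemma clique_factor_power_Suc:
  assumes "x \<ge> 0"
  shows "clique_factor k x ^ (k + 1) = real (k + 1) * x + 1"
proof -
  have "real (k + 1) * x + 1 > 0"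
    using assms by (simp add: add_nonneg_pos)
  then show ?thesis
    unfolding clique_factor_power[OF assms] by simp
qed

text \<open>Young's inequality for \<open>?T ^ (k + 1) * 1\<close> with conjugate exponents
  \<open>(k + 2) / (k + 1)\<close> and \<open>k + 2\<close> produces \<open>?T ^ (k + 2)\<close>,
  which is affine in \<open>x\<close>; the resulting bound is exactly
  \<open>(k + 1) * x + 1\<close>.\<close>

lemma clique_factor_Suc_le:
  assumes "x \<ge> 0"
  shows "clique_factor (Suc k) x \<le> clique_factor k x"
proof -
  let ?T = "clique_factor (Suc k) x"
  have T: "?T > 0"
    using assms by (rule clique_factor_pos)
  have "?T ^ (k + 1) * 1 \<le> (?T ^ (k + 1)) powr ((k + 2) / (k + 1)) / ((k + 2) / (k + 1))
          + 1 powr (real (k + 2)) / real (k + 2)"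
    using T by (intro Youngs_inequality) (auto simp: field_simps)
  also have "(?T ^ (k + 1)) powr ((k + 2) / (k + 1)) = ?T ^ (k + 2)"
  proof -
    have "(?T ^ (k + 1)) powr ((k + 2) / (k + 1)) = (?T powr real (k + 1)) powr ((k + 2) / (k + 1))"
      using T by (simp only: powr_realpow)
    also have "\<dots> = ?T powr real (k + 2)"
    proof -
      have "real k + 1 \<noteq> 0" by linarith
      then have "real (k + 1) * ((k + 2) / (k + 1)) = real (k + 2)"
        by (simp add: add.commute)
      then show ?thesis by (simp only: powr_powr)
    qed
    finally show ?thesis
      using T by (simp only: powr_realpow)
  qed
  also have "?T ^ (k + 2) = real (k + 2) * x + 1"
    using clique_factor_power_Suc[OF assms, of "Suc k"] by simp
  also have "(real (k + 2) * x + 1) / ((k + 2) / (k + 1)) + 1 powr (real (k + 2)) / real (k + 2)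
      = real (k + 1) * x + 1"
    by (simp add: field_simps)
  also have "\<dots> = clique_factor k x ^ (k + 1)"
    using clique_factor_power_Suc[OF assms] by simp
  finally show ?thesis
    using clique_factor_pos[OF assms, of k] power_le_imp_le_base[of ?T k "clique_factor k x"]
    by simp
qed

lemma clique_factor_antimono: "x \<ge> 0 \<Longrightarrow> j \<le> k \<Longrightarrow> clique_factor k x \<le> clique_factor j x"
  by (rule lift_Suc_antimono_le[of "\<lambda>k. clique_factor k x"]) (auto intro: clique_factor_Suc_le)

text \<open>
  Equality holds at \<open>x = 0\<close>, and the difference of the two sides has derivative
  \<open>d * (clique_factor k x ^ (d - Suc k) - clique_factor (Suc k) x ^ (d - Suc k))\<close>.
\<close>

lemma clique_factor_power_lower:
  assumes "x \<ge> 0" "Suc k \<le> d"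
  shows "1 / real (d + 1) + real d / real (d + 1) * clique_factor (Suc k) x ^ (d + 1)
           \<le> clique_factor k x ^ d"
proof -
  define h where "h = (\<lambda>t. (real (k + 1) * t + 1) powr (real d / real (k + 1))
      - real d / real (d + 1) * (real (k + 2) * t + 1) powr (real (d + 1) / real (k + 2)))"
  have "h 0 \<le> h x"
  proof (rule DERIV_nonneg_imp_nondecreasing[OF assms(1)])
    fix t :: real
    assume t: "0 \<le> t" "t \<le> x"
    have pos: "real (k + 1) * t + 1 > 0" "real (k + 2) * t + 1 > 0"
      using t by (auto intro: add_nonneg_pos)
    \<comment> \<open>By \<open>Suc k \<le> d\<close> the subtraction \<open>d - Suc k\<close> is
      exact, so both powers in the derivative become natural powers that \<open>power_mono\<close>
      can compare.\<close>
    have e: "real d / real (k + 1) - 1 = real (d - Suc k) / real (k + 1)"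
         "real (d + 1) / real (k + 2) - 1 = real (d - Suc k) / real (k + 2)"
      using assms(2) by (auto simp: field_simps of_nat_diff)
    have "(h has_real_derivative
         (real d / real (k + 1)) * (real (k + 1) * t + 1) powr (real d / real (k + 1) - 1) * real (k + 1)
         - real d / real (d + 1) * ((real (d + 1) / real (k + 2))
             * (real (k + 2) * t + 1) powr (real (d + 1) / real (k + 2) - 1) * real (k + 2))) (at t)"
      unfolding h_def using pos
      by (auto intro!: derivative_eq_intros simp del: of_nat_add of_nat_Suc)
    also have "(real d / real (k + 1)) * (real (k + 1) * t + 1) powr (real d / real (k + 1) - 1) * real (k + 1)
         = real d * clique_factor k t ^ (d - Suc k)"
      unfolding e clique_factor_power[OF t(1)] by simp
    also have "real d / real (d + 1) * ((real (d + 1) / real (k + 2))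
             * (real (k + 2) * t + 1) powr (real (d + 1) / real (k + 2) - 1) * real (k + 2))
         = real d * clique_factor (Suc k) t ^ (d - Suc k)"
      unfolding e clique_factor_power[OF t(1)] by (simp del: of_nat_add of_nat_Suc)
    finally have "(h has_real_derivative real d * clique_factor k t ^ (d - Suc k)
        - real d * clique_factor (Suc k) t ^ (d - Suc k)) (at t)" .
    moreover have "real d * clique_factor (Suc k) t ^ (d - Suc k) \<le> real d * clique_factor k t ^ (d - Suc k)"
      using clique_factor_pos[OF t(1), of "Suc k"]
      by (intro mult_left_mono power_mono clique_factor_Suc_le t) auto
    ultimately show "\<exists>y. (h has_real_derivative y) (at t) \<and> 0 \<le> y"
      by (intro exI conjI) auto
  qed
  moreover have "h 0 = 1 / real (d + 1)"
    by (simp add: h_def field_simps)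
  moreover have "h x = clique_factor k x ^ d - real d / real (d + 1) * clique_factor (Suc k) x ^ (d + 1)"
    unfolding h_def clique_factor_power[OF assms(1)] by simp
  ultimately show ?thesis
    by linarith
qed

section \<open>The inequality around a deleted vertex\<close>

text \<open>This is the induction step without the factors of the non-neighbours: \<open>y\<close>
  is the weight of the deleted vertex and \<open>N\<close> its neighbourhood.\<close>

lemma clique_factor_neighbourhood:
  fixes w :: "'a \<Rightarrow> real" and k :: "'a \<Rightarrow> nat"
  assumes "finite N" "y \<ge> 0" "\<And>u. u \<in> N \<Longrightarrow> w u \<ge> 0"
    and "\<And>u. u \<in> N \<Longrightarrow> 1 \<le> k u \<and> k u \<le> card N"
  shows "clique_factor (card N) y * (\<Prod>u\<in>N. clique_factor (k u) (w u))
           \<le> (\<Prod>u\<in>N. clique_factor (k u - 1) (w u)) + y"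
proof (cases "N = {}")
  case True
  then show ?thesis
    using assms(2) by (simp add: clique_factor_def)
next
  case False
  define d where "d = card N"
  have d: "d \<ge> 1"
    using False assms(1) by (simp add: d_def Suc_le_eq card_gt_0_iff)
  let ?g = "\<lambda>u. clique_factor (k u) (w u)" and ?a = "\<lambda>u. clique_factor (k u - 1) (w u)"
  let ?x = "1 / real (d + 1)" and ?z = "\<lambda>u. real d / real (d + 1) * ?g u ^ (d + 1)"
  let ?Y = "clique_factor d y" and ?P = "\<Prod>u\<in>N. ?g u" and ?A = "\<Prod>u\<in>N. ?a u"
  have g: "?g u > 0" and a: "?a u > 0" if "u \<in> N" for u
    using assms(3)[OF that] by (simp_all add: clique_factor_pos)
  have P: "?P > 0" and A: "?A > 0"
    using g a by (auto intro: prod_pos)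
  have z: "?z u > 0" if "u \<in> N" for u
    using g[OF that] d by simp
  \<comment> \<open>\<open>1 \<le> k u\<close> makes \<open>k u - 1\<close> a true predecessor, and
    \<open>k u \<le> card N\<close> allows the same exponent \<open>d\<close> for all
    neighbours.\<close>
  have xa: "?x + ?z u \<le> ?a u ^ d" if "u \<in> N" for u
    using clique_factor_power_lower[of "w u" "k u - 1" d] assms(3,4)[OF that] d_def by simp
  \<comment> \<open>The exponent \<open>d + 1\<close> makes the first term
    \<open>y + 1 / (d + 1)\<close>; the surplus \<open>1 / (d + 1)\<close> is the \<open>?x\<close>
    used below.\<close>
  have "?Y * ?P \<le> ?Y powr real (d + 1) / real (d + 1) + ?P powr ((d + 1) / d) / ((d + 1) / d)"
    using d P clique_factor_pos[OF assms(2), of d]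
    by (intro Youngs_inequality) (auto simp: field_simps)
  also have "?Y powr real (d + 1) = real (d + 1) * y + 1"
    using clique_factor_pos[OF assms(2), of d] clique_factor_power_Suc[OF assms(2), of d]
    by (simp only: powr_realpow)
  also have "(real (d + 1) * y + 1) / real (d + 1) + ?P powr ((d + 1) / d) / ((d + 1) / d)
      = y + (?x + real d / real (d + 1) * ?P powr ((d + 1) / d))"
  proof -
    have "(e * y + 1) / e + Q / (e / c) = y + (1 / e + c / e * Q)" if "e \<noteq> 0" for c e Q :: real
      using that by (simp add: field_simps)
    from this[of "real (d + 1)"] show ?thesis by simp
  qed
  \<comment> \<open>The two summands are the geometric means of the constant family
    \<open>?x\<close> and of \<open>?z\<close>. Superadditivity merges them, and \<open>xa\<close>
    then bounds the result by the geometric mean of the \<open>?a u ^ d\<close>.\<close>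
  also have "?x + real d / real (d + 1) * ?P powr ((d + 1) / d) \<le> ?A"
  proof -
    have x': "(\<Prod>u\<in>N. ?x) powr (1 / card N) = ?x"
    proof -
      have "(\<Prod>u\<in>N. ?x) = ?x powr real d"
        by (simp only: prod_constant d_def[symmetric]) (simp add: powr_realpow)
      then show ?thesis
        using d by (simp add: d_def[symmetric] powr_powr)
    qed
    have z': "(\<Prod>u\<in>N. ?z u) powr (1 / card N) = real d / real (d + 1) * ?P powr ((d + 1) / d)"
    proof -
      have "(\<Prod>u\<in>N. ?z u) = (real d / real (d + 1)) ^ d * ?P ^ (d + 1)"
        by (simp only: prod.distrib prod_constant d_def[symmetric] prod_power_distrib)
      also have "\<dots> = (real d / real (d + 1)) powr real d * ?P powr real (d + 1)"
        using d P by (simp only: powr_realpow) (simp add: powr_realpow)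
      finally have e: "(\<Prod>u\<in>N. ?z u) = (real d / real (d + 1)) powr real d * ?P powr real (d + 1)" .
      show ?thesis
        unfolding e d_def[symmetric] using d P by (simp add: powr_mult powr_powr)
    qed
    have "?x + real d / real (d + 1) * ?P powr ((d + 1) / d) \<le> (\<Prod>u\<in>N. ?x + ?z u) powr (1 / card N)"
      using geometric_mean_superadditive[OF assms(1) False, of "\<lambda>_. ?x" ?z] z
      unfolding x' z' by simp
    also have "\<dots> \<le> (\<Prod>u\<in>N. ?a u ^ d) powr (1 / card N)"
    proof (intro powr_mono2 prod_mono prod_nonneg)
      show "0 \<le> ?x + ?z u" if "u \<in> N" for u
        using z[OF that] by (intro add_nonneg_nonneg) auto
      then show "0 \<le> ?x + ?z u \<and> ?x + ?z u \<le> ?a u ^ d" if "u \<in> N" for u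
        using xa that by blast
    qed auto
    also have "\<dots> = (?A powr real d) powr (1 / d)"
      using A by (simp only: prod_power_distrib[symmetric] d_def[symmetric] powr_realpow)
    also have "\<dots> = ?A"
      using d A by (simp add: powr_powr)
    finally show ?thesis .
  qed
  finally show ?thesis
    by (simp add: d_def add.commute)
qed

section \<open>Weighted independent set sums under vertex deletion\<close>

text \<open>Induced subgraphs are given by \<open>S\<close> alone with \<open>E\<close> fixed, so
  deleting vertices only shrinks \<open>S\<close>.\<close>

definition indep :: "'a set set \<Rightarrow> 'a set \<Rightarrow> 'a set set" where
  "indep E S = {I. I \<subseteq> S \<and> (\<forall>u\<in>I. \<forall>v\<in>I. {u, v} \<notin> E)}"

definition nbrs :: "'a set set \<Rightarrow> 'a set \<Rightarrow> 'a \<Rightarrow> 'a set" where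
  "nbrs E S v = {u \<in> S. {v, u} \<in> E}"

lemma finite_indep: "finite S \<Longrightarrow> finite (indep E S)"
  by (rule finite_subset[of _ "Pow S"]) (auto simp: indep_def)

text \<open>The sets are split by whether they contain \<open>v\<close>; those that do correspond to
  independent sets avoiding \<open>v\<close> and its neighbours. A loop \<open>{v}\<close> in
  \<open>E\<close> would exclude \<open>v\<close> from every independent set.\<close>

lemma indep_sum_recurrence:
  fixes w :: "'a \<Rightarrow> real"
  assumes "finite S" "v \<in> S" "{v} \<notin> E"
  shows "(\<Sum>I\<in>indep E S. prod w I) = (\<Sum>I\<in>indep E (S - {v}). prod w I)
           + w v * (\<Sum>I\<in>indep E (S - {v} - nbrs E S v). prod w I)"
proof -
  let ?R = "S - {v} - nbrs E S v"
  have split: "indep E S = indep E (S - {v}) \<union> insert v ` indep E ?R"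
  proof (intro equalityI subsetI)
    fix I assume I: "I \<in> indep E S"
    show "I \<in> indep E (S - {v}) \<union> insert v ` indep E ?R"
    proof (cases "v \<in> I")
      case True
      then have "I - {v} \<in> indep E ?R" "I = insert v (I - {v})"
        using I by (auto simp: indep_def nbrs_def)
      then show ?thesis by blast
    next
      case False
      then show ?thesis using I by (auto simp: indep_def)
    qed
  next
    fix I assume "I \<in> indep E (S - {v}) \<union> insert v ` indep E ?R"
    then show "I \<in> indep E S"
      using assms(2,3) by (auto simp: indep_def nbrs_def insert_commute subset_iff)
  qed
  have inj: "inj_on (insert v) (indep E ?R)"
    by (rule inj_onI) (auto simp: indep_def)
  have "(\<Sum>I\<in>indep E S. prod w I) = (\<Sum>I\<in>indep E (S - {v}). prod w I)
      + (\<Sum>I\<in>insert v ` indep E ?R. prod w I)"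
    unfolding split using assms(1)
    by (intro sum.union_disjoint) (auto simp: finite_indep, auto simp: indep_def)
  also have "(\<Sum>I\<in>insert v ` indep E ?R. prod w I) = (\<Sum>I\<in>indep E ?R. prod w (insert v I))"
    using inj by (simp add: sum.reindex)
  also have "\<dots> = (\<Sum>I\<in>indep E ?R. w v * prod w I)"
  proof (rule sum.cong[OF refl])
    fix I assume "I \<in> indep E ?R"
    then have "finite I" "v \<notin> I"
      using assms(1) by (auto simp: indep_def intro: finite_subset[of I S])
    then show "prod w (insert v I) = w v * prod w I" by simp
  qed
  finally show ?thesis
    by (simp add: sum_distrib_left)
qed

text \<open>The induction runs over all proper subsets because the recurrence leads both to
  \<open>S - {v}\<close> and to \<open>S\<close> without the closed neighbourhood of
  \<open>v\<close>.\<close>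

lemma indep_sum_lower_bound:
  fixes w :: "'a \<Rightarrow> real"
  assumes "finite S" "\<And>v. {v} \<notin> E" "\<And>v. v \<in> S \<Longrightarrow> w v \<ge> 0"
  shows "(\<Prod>v\<in>S. clique_factor (card (nbrs E S v)) (w v)) \<le> (\<Sum>I\<in>indep E S. prod w I)"
  using assms(1,3)
proof (induction S rule: finite_psubset_induct)
  case (psubset S)
  show ?case
  proof (cases "S = {}")
    case True
    then have "indep E S = {{}}" by (auto simp: indep_def)
    then show ?thesis using True by simp
  next
    case False
    define k where "k = (\<lambda>u. card (nbrs E S u))"
    have "Max (k ` S) \<in> k ` S"
      using False psubset.hyps by (intro Max_in) auto
    then obtain v where v: "v \<in> S" "k v = Max (k ` S)" by auto
    then have max: "k u \<le> k v" if "u \<in> S" for u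
      using that psubset.hyps by auto
    define N R where "N = nbrs E S v" and "R = S - {v} - N"
    have S: "finite S" by fact
    have fin: "finite N" "finite R" "finite (S - {v})"
      using S by (auto simp: N_def R_def nbrs_def)
    have NR: "S - {v} = N \<union> R" "N \<inter> R = {}"
      using assms(2)[of v] by (auto simp: N_def R_def nbrs_def)
    have w: "w u \<ge> 0" if "u \<in> S" for u
      using that by (rule psubset.prems)
    have sub: "N \<subseteq> S" "R \<subseteq> S" by (auto simp: N_def R_def nbrs_def)
    have vu: "v \<in> nbrs E S u" if "u \<in> N" for u
      using that v(1) by (auto simp: N_def nbrs_def insert_commute)
    have finb: "finite (nbrs E S u)" for u
      using S by (simp add: nbrs_def)
    have kN: "card (nbrs E (S - {v}) u) = k u - 1" if "u \<in> N" for u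
    proof -
      have "nbrs E (S - {v}) u = nbrs E S u - {v}" by (auto simp: nbrs_def)
      then show ?thesis using vu[OF that] by (simp add: k_def)
    qed
    have kR: "card (nbrs E (S - {v}) u) = k u" if "u \<in> R" for u
    proof -
      have "nbrs E (S - {v}) u = nbrs E S u"
        using that by (auto simp: nbrs_def R_def N_def insert_commute)
      then show ?thesis by (simp add: k_def)
    qed
    have kR': "card (nbrs E R u) \<le> k u" for u
      unfolding k_def by (intro card_mono finb) (auto simp: nbrs_def R_def)
    let ?Q = "\<Prod>u\<in>R. clique_factor (k u) (w u)"
    let ?A = "\<Prod>u\<in>N. clique_factor (k u - 1) (w u)"
    let ?P = "\<Prod>u\<in>N. clique_factor (k u) (w u)"
    have Q: "?Q \<ge> 0"
      using w sub by (intro prod_nonneg) (auto intro: less_imp_le[OF clique_factor_pos])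
    have "(\<Prod>u\<in>S - {v}. clique_factor (card (nbrs E (S - {v}) u)) (w u)) = ?A * ?Q"
      unfolding NR(1) using fin NR(2) kN kR by (subst prod.union_disjoint) (simp_all flip: NR(1))
    then have del: "?A * ?Q \<le> (\<Sum>I\<in>indep E (S - {v}). prod w I)"
      using psubset.IH[of "S - {v}"] v(1) w by auto
    \<comment> \<open>Degrees inside \<open>R\<close> may have dropped by any amount, but
      antitonicity restores the degrees in \<open>S\<close>, so both branches share the factor
      \<open>?Q\<close>.\<close>
    have "?Q \<le> (\<Prod>u\<in>R. clique_factor (card (nbrs E R u)) (w u))"
      using w sub
      by (intro prod_mono) (auto intro: less_imp_le[OF clique_factor_pos] clique_factor_antimono kR')
    also have "\<dots> \<le> (\<Sum>I\<in>indep E R. prod w I)"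
      using psubset.IH[of R] v(1) w by (auto simp: R_def)
    finally have con: "?Q \<le> (\<Sum>I\<in>indep E R. prod w I)" .
    have "(\<Prod>u\<in>S. clique_factor (k u) (w u)) = clique_factor (k v) (w v) * (?P * ?Q)"
      using S v(1) fin NR by (simp add: prod.remove[of S v] prod.union_disjoint)
    also have "\<dots> = (clique_factor (card N) (w v) * ?P) * ?Q"
      by (simp add: k_def N_def)
    also have "\<dots> \<le> (?A + w v) * ?Q"
    proof (intro mult_right_mono Q clique_factor_neighbourhood fin w v(1))
      fix u assume u: "u \<in> N"
      then show "u \<in> S" using sub by auto
      show "1 \<le> k u \<and> k u \<le> card N"
        using vu[OF u] finb[of u] max[of u] u sub
        by (auto simp: k_def N_def Suc_le_eq card_gt_0_iff)
    qed
    also have "\<dots> = ?A * ?Q + w v * ?Q"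
      by (simp add: distrib_right)
    also have "\<dots> \<le> (\<Sum>I\<in>indep E (S - {v}). prod w I) + w v * (\<Sum>I\<in>indep E R. prod w I)"
      using w v(1) by (intro add_mono del mult_left_mono con) auto
    also have "\<dots> = (\<Sum>I\<in>indep E S. prod w I)"
      using indep_sum_recurrence[OF S v(1) assms(2)] by (simp add: R_def N_def)
    finally show ?thesis by (simp add: k_def)
  qed
qed

section \<open>From graphs to weighted sums\<close>

lemma (in graph) singleton_notin_edges: "{v} \<notin> edges G"
  using no_loops by (fastforce simp: edges_def)

text \<open>\<open>head G\<close> maps the arcs leaving \<open>v\<close> onto its neighbours by
  symmetry, and injectively since there are no parallel arcs.\<close>

lemma (in graph) out_degree_eq_card_nbrs:
  "out_degree G v = card (nbrs (edges G) (verts G) v)"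
proof -
  have "nbrs (edges G) (verts G) v = head G ` out_arcs G v"
  proof (intro equalityI subsetI)
    fix u assume "u \<in> nbrs (edges G) (verts G) v"
    then obtain a where a: "a \<in> arcs G" "{v, u} = {tail G a, head G a}"
      by (auto simp: nbrs_def edges_def)
    then have "(tail G a, head G a) \<in> arcs_ends G"
      by (auto simp: arcs_ends_def arc_to_ends_def)
    then have "(v, u) \<in> arcs_ends G"
      using a(2) sym_arcs by (auto simp: doubleton_eq_iff symmetric_def sym_def)
    then show "u \<in> head G ` out_arcs G v"
      by (auto simp: arcs_ends_def arc_to_ends_def)
  qed (auto simp: nbrs_def edges_def)
  moreover have "inj_on (head G) (out_arcs G v)"
    by (rule inj_onI) (auto intro!: no_multi_arcs simp: arc_to_ends_def)
  ultimately show ?thesis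
    by (simp add: out_degree_def card_image)
qed

text \<open>Every edge meeting \<open>I\<close> is cut and has exactly one endpoint in
  \<open>I\<close>, so counting by that endpoint is free of repetition.\<close>

lemma (in graph) cut_size_independent:
  assumes "I \<in> independent_sets G"
  shows "cut_size G I = (\<Sum>v\<in>I. out_degree G v)"
proof -
  have I: "I \<subseteq> verts G" "\<And>u v. u \<in> I \<Longrightarrow> v \<in> I \<Longrightarrow> {u, v} \<notin> edges G"
    using assms by (auto simp: independent_sets_def)
  let ?N = "nbrs (edges G) (verts G)"
  have "{e \<in> edges G. \<exists>u\<in>I. \<exists>v\<in>verts G - I. e = {u, v}} = (\<lambda>(u, v). {u, v}) ` Sigma I ?N"
    using I(2) by (fastforce simp: nbrs_def)
  moreover have "inj_on (\<lambda>(u, v). {u, v}) (Sigma I ?N)"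
    using I(2) by (auto simp: inj_on_def nbrs_def doubleton_eq_iff)
  ultimately have "cut_size G I = card (Sigma I ?N)"
    by (simp add: cut_size_def card_image)
  also have "\<dots> = (\<Sum>v\<in>I. card (?N v))"
    using I(1) finite_subset[of I "verts G"] by (intro card_SigmaI) (auto simp: nbrs_def)
  finally show ?thesis by (simp add: out_degree_eq_card_nbrs)
qed

text \<open>The cut size is additive over \<open>I\<close>, so each summand factors into vertex
  weights.\<close>

lemma (in graph) Z_eq_weighted_sum:
  "Z G lam \<alpha> = (\<Sum>I\<in>indep (edges G) (verts G). \<Prod>v\<in>I. lam * \<alpha> ^ out_degree G v)"
proof -
  have "independent_sets G = indep (edges G) (verts G)"
    by (simp add: independent_sets_def indep_def)
  then show ?thesis
    unfolding Z_def
    by (intro sum.cong) (auto simp: cut_size_independent prod.distrib power_sum)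
qed

text \<open>The empty set contributes 1, and the only other independent sets are the
  \<open>n + 1\<close> singletons.\<close>

lemma Z_complete_graph:
  "Z (complete_graph (n + 1)) lam \<alpha> = real (n + 1) * lam * \<alpha> ^ n + 1"
proof -
  let ?K = "complete_graph (n + 1)"
  interpret graph ?K
    using complete_digraph_complete_graph[of "n + 1"] by (simp add: complete_digraph_def)
  have edge: "{u, v} \<in> edges ?K \<longleftrightarrow> u < n + 1 \<and> v < n + 1 \<and> u \<noteq> v" for u v
    by (force simp: edges_def complete_graph_def doubleton_eq_iff)
  have V: "verts ?K = {..<n + 1}"
    by (simp add: complete_graph_def)
  have deg: "out_degree ?K v = n" if "v < n + 1" for v
  proof -
    have "nbrs (edges ?K) (verts ?K) v = {..<n + 1} - {v}"
      unfolding nbrs_def V edge using that by auto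
    then show ?thesis
      unfolding out_degree_eq_card_nbrs using that by simp
  qed
  have S: "indep (edges ?K) (verts ?K) = insert {} ((\<lambda>v. {v}) ` {..<n + 1})"
  proof (intro equalityI subsetI)
    fix I assume "I \<in> indep (edges ?K) (verts ?K)"
    then have "I \<subseteq> {..<n + 1}" "\<And>u v. u \<in> I \<Longrightarrow> v \<in> I \<Longrightarrow> u = v"
      unfolding indep_def V edge by auto
    then show "I \<in> insert {} ((\<lambda>v. {v}) ` {..<n + 1})"
      by (cases "I = {}") blast+
  qed (unfold indep_def V edge, auto)
  have "Z ?K lam \<alpha> = 1 + (\<Sum>I\<in>(\<lambda>v. {v}) ` {..<n + 1}. \<Prod>v\<in>I. lam * \<alpha> ^ out_degree ?K v)"
    unfolding Z_eq_weighted_sum S by (subst sum.insert) auto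
  also have "\<dots> = 1 + (\<Sum>v<n + 1. lam * \<alpha> ^ out_degree ?K v)"
    by (subst sum.reindex) auto
  also have "(\<Sum>v<n + 1. lam * \<alpha> ^ out_degree ?K v) = (\<Sum>v<n + 1. lam * \<alpha> ^ n)"
    by (intro sum.cong refl) (simp only: deg lessThan_iff)
  finally show ?thesis
    by (simp add: algebra_simps)
qed

theorem theorem1p2:
  fixes G :: "('a, 'b) pre_digraph" and lam \<alpha> :: real
  assumes "graph G" and "lam \<ge> 0" and "\<alpha> \<ge> 0"
  shows "Z G lam \<alpha> \<ge>
           (\<Prod>v\<in>verts G. Z (complete_graph (out_degree G v + 1)) lam \<alpha>
                            powr (1 / real (out_degree G v + 1)))
       \<and> (\<Prod>v\<in>verts G. Z (complete_graph (out_degree G v + 1)) lam \<alpha>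
                            powr (1 / real (out_degree G v + 1)))
         = (\<Prod>v\<in>verts G. (real (out_degree G v + 1) * lam * \<alpha> ^ out_degree G v + 1)
                            powr (1 / real (out_degree G v + 1)))"
proof -
  interpret graph G by fact
  \<comment> \<open>The weights use degrees in the whole graph and stay fixed throughout the
    induction on vertex sets.\<close>
  have "(\<Prod>v\<in>verts G. clique_factor (out_degree G v) (lam * \<alpha> ^ out_degree G v)) \<le> Z G lam \<alpha>"
    unfolding Z_eq_weighted_sum
    using indep_sum_lower_bound[of "verts G" "edges G" "\<lambda>v. lam * \<alpha> ^ out_degree G v"]
      singleton_notin_edges assms(2,3)
    by (simp add: out_degree_eq_card_nbrs)
  then show ?thesis
    unfolding Z_complete_graph clique_factor_def by (simp add: mult.assoc)
qed

end
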